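(* Every digraph $D$ is $k$-mixing for every integer $k\ge \delta^*_{\min}(D)+2$.
   Context: A $k$-dicolouring of a digraph $D$ is a map $\alpha:V(D)\to\{1,\dots,k\}$ such that no directed cycle is monochromatic. The $k$-dicolouring graph ${\cal D}_k(D)$ has as vertices the $k$-dicolourings of $D$, two being adjacent if they differ on exactly one vertex; $D$ is $k$-mixing if ${\cal D}_k(D)$ is connected. The min-degeneracy is $\delta^*_{\min}(D)=\max\{\min\{\delta^+(H),\delta^-(H)\} : H \text{ subdigraph of } D\}$, where $\delta^+,\delta^-$ denote minimum out- and in-degree. *)

theory Defs
  imports "HOL-Library.FuncSet" "Graph_Theory.Graph_Theory"
begin

text \<open>
  Digraphs are those of the locale \<open>digraph\<close>: finite, without loops and without parallel arcs
  of the same direction; digons are allowed and count as directed cycles (of length 2).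
\<close>

definition min_out_degree :: "('a, 'b) pre_digraph \<Rightarrow> nat" where
  "min_out_degree H = Min (out_degree H ` verts H)"

definition min_in_degree :: "('a, 'b) pre_digraph \<Rightarrow> nat" where
  "min_in_degree H = Min (in_degree H ` verts H)"

text \<open>
  The maximum ranges over the non-null subdigraphs, since only these have minimum degrees. On a
  finite set of naturals \<open>Sup\<close> is \<open>Max\<close>, except that it gives the null digraph min-degeneracy 0.
\<close>
definition min_degeneracy :: "('a, 'b) pre_digraph \<Rightarrow> nat" where
  "min_degeneracy D =
    Sup {min (min_out_degree H) (min_in_degree H) | H. subgraph H D \<and> verts H \<noteq> {}}"

lemma min_degeneracy_eq_Max:
  assumes "digraph D" and "verts D \<noteq> {}"
  shows "min_degeneracy D =
    Max {min (min_out_degree H) (min_in_degree H) | H. subgraph H D \<and> verts H \<noteq> {}}"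
proof -
  interpret digraph D by fact
  let ?S = "{H. subgraph H D \<and> verts H \<noteq> {}}"
  have "?S \<subseteq> (\<lambda>(V, A). \<lparr>verts = V, arcs = A, tail = tail D, head = head D\<rparr>)
    ` (Pow (verts D) \<times> Pow (arcs D))"
  proof
    fix H assume "H \<in> ?S"
    then have "H = (\<lambda>(V, A). \<lparr>verts = V, arcs = A, tail = tail D, head = head D\<rparr>)
        (verts H, arcs H)"
      and "(verts H, arcs H) \<in> Pow (verts D) \<times> Pow (arcs D)"
      by (auto simp: subgraph_def compatible_def)
    then show "H \<in> (\<lambda>(V, A). \<lparr>verts = V, arcs = A, tail = tail D, head = head D\<rparr>)
        ` (Pow (verts D) \<times> Pow (arcs D))"
      by (rule image_eqI)
  qed
  then have "finite ?S"
    by (rule finite_subset) simp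
  moreover have "D \<in> ?S"
    using assms(2) by (simp add: subgraph_def compatible_def wf_digraph)
  ultimately show ?thesis
    unfolding min_degeneracy_def Sup_nat_def by auto
qed

text \<open>
  Every vertex of a directed cycle is the tail of exactly one of its arcs, so the colours
  occurring on the cycle are those of the tails.
\<close>
definition monochromatic :: "('a, 'b) pre_digraph \<Rightarrow> ('a \<Rightarrow> 'c) \<Rightarrow> 'b list \<Rightarrow> bool" where
  "monochromatic D \<alpha> p \<longleftrightarrow> (\<exists>c. \<forall>e\<in>set p. \<alpha> (tail D e) = c)"

text \<open>
  Colourings are extensional functions, so that distinct colourings differ on a vertex of the
  digraph.
\<close>
definition dicolouring :: "('a, 'b) pre_digraph \<Rightarrow> nat \<Rightarrow> ('a \<Rightarrow> nat) \<Rightarrow> bool" where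
  "dicolouring D k \<alpha> \<longleftrightarrow>
    \<alpha> \<in> verts D \<rightarrow>\<^sub>E {1..k} \<and> (\<forall>p. pre_digraph.cycle D p \<longrightarrow> \<not> monochromatic D \<alpha> p)"

text \<open>An undirected graph is represented by a symmetric digraph.\<close>
definition dicolouring_graph :: "('a, 'b) pre_digraph \<Rightarrow> nat \<Rightarrow> ('a \<Rightarrow> nat) pair_pre_digraph" where
  "dicolouring_graph D k =
    \<lparr> pverts = {\<alpha>. dicolouring D k \<alpha>},
      parcs = {(\<alpha>, \<beta>). dicolouring D k \<alpha> \<and> dicolouring D k \<beta> \<and> (\<exists>!v. v \<in> verts D \<and> \<alpha> v \<noteq> \<beta> v)} \<rparr>"

text \<open>
  The library's \<open>connected\<close> (shadowing the topological notion here) also requires the graph to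
  be non-null.
\<close>
definition k_mixing :: "('a, 'b) pre_digraph \<Rightarrow> nat \<Rightarrow> bool" where
  "k_mixing D k \<longleftrightarrow> Digraph_Component.connected (with_proj (dicolouring_graph D k))"

end

(*
  Induction on the vertex set: some vertex v has at most k - 2 out-neighbours or at most k - 2
  in-neighbours; let N be that set of neighbours. Every directed cycle through v meets N, so v may
  receive any colour absent from N. A recolouring sequence of D - v lifts to D: before another vertex
  u receives its new colour c, move v to a colour that differs from c and is absent from N, which
  leaves at least one choice.
*)
theory Submission
  imports Defs
begin

section \<open>Recolouring hypergraphs\<close>

text \<open>For dicolourings, \<open>F\<close> will consist of the vertex sets of directed cycles.
  Hyperedges not contained in \<open>S\<close> are ignored, so \<open>F\<close> stays fixed while
  vertices are deleted from \<open>S\<close>.\<close>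

definition proper_colouring :: "'a set set \<Rightarrow> 'c set \<Rightarrow> 'a set \<Rightarrow> ('a \<Rightarrow> 'c) \<Rightarrow> bool" where
  "proper_colouring F C S \<alpha> \<longleftrightarrow>
    \<alpha> \<in> S \<rightarrow>\<^sub>E C \<and> (\<forall>X\<in>F. X \<subseteq> S \<longrightarrow> \<not> (\<exists>c. \<forall>x\<in>X. \<alpha> x = c))"

definition recolouring :: "'a set set \<Rightarrow> 'c set \<Rightarrow> 'a set \<Rightarrow> ('a \<Rightarrow> 'c) rel" where
  "recolouring F C S = {(\<alpha>, \<beta>). proper_colouring F C S \<alpha> \<and> proper_colouring F C S \<beta> \<and>
    (\<exists>!v. v \<in> S \<and> \<alpha> v \<noteq> \<beta> v)}"

text \<open>\<open>N\<close> is a transversal of the hyperedges inside \<open>S\<close> through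
  \<open>v\<close>. Since \<open>N\<close> avoids \<open>v\<close>, giving \<open>v\<close> a colour
  absent from \<open>N\<close> leaves two colours on each of them.\<close>

definition blocks :: "'a set set \<Rightarrow> 'a set \<Rightarrow> 'a set \<Rightarrow> 'a \<Rightarrow> bool" where
  "blocks F S N v \<longleftrightarrow> N \<subseteq> S - {v} \<and> (\<forall>X\<in>F. X \<subseteq> S \<longrightarrow> v \<in> X \<longrightarrow> X \<inter> N \<noteq> {})"

text \<open>A single step must change a colour; the reflexive closure also covers the case where the
  new colour is the old one.\<close>

lemma recolouring_at_vertex:
  assumes "proper_colouring F C S \<alpha>" and "proper_colouring F C S \<beta>"
    and "\<And>x. x \<noteq> v \<Longrightarrow> \<alpha> x = \<beta> x"
  shows "(\<alpha>, \<beta>) \<in> (recolouring F C S)\<^sup>*"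
proof (cases "\<alpha> = \<beta>")
  case False
  then have "\<alpha> v \<noteq> \<beta> v"
    using assms(3) by (metis ext)
  moreover from this have "v \<in> S"
    using assms(1,2) by (metis PiE_arb proper_colouring_def)
  ultimately have "\<exists>!v. v \<in> S \<and> \<alpha> v \<noteq> \<beta> v"
    using assms(3) by metis
  then show ?thesis
    using assms(1,2) by (auto simp: recolouring_def)
qed simp

text \<open>A hyperedge through \<open>v\<close> meets \<open>N\<close> in a vertex not coloured
  \<open>c\<close>; one that misses \<open>v\<close> lies in \<open>S - {v}\<close>, where \<alpha>
  is already proper.\<close>

lemma proper_colouring_fun_upd:
  assumes \<alpha>: "proper_colouring F C (S - {v}) \<alpha>" and "v \<in> S"
    and N: "blocks F S N v"
    and "c \<in> C" and c: "c \<notin> \<alpha> ` N"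
  shows "proper_colouring F C S (\<alpha>(v := c))"
  unfolding proper_colouring_def
proof (intro conjI ballI impI notI)
  show "\<alpha>(v := c) \<in> S \<rightarrow>\<^sub>E C"
    using \<alpha> assms(2,4) by (auto simp: proper_colouring_def PiE_iff extensional_def)
next
  fix X assume X: "X \<in> F" "X \<subseteq> S" and "\<exists>d. \<forall>x\<in>X. (\<alpha>(v := c)) x = d"
  then obtain d where d: "\<And>x. x \<in> X \<Longrightarrow> (\<alpha>(v := c)) x = d"
    by blast
  show False
  proof (cases "v \<in> X")
    case True
    then obtain w where "w \<in> X" "w \<in> N" "w \<noteq> v"
      using N X unfolding blocks_def by blast
    then show False
      using d[OF True] d[of w] c by auto
  next
    case False
    then have "X \<subseteq> S - {v}" "\<forall>x\<in>X. \<alpha> x = d"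
      using X d by (fastforce split: if_splits)+
    then show False
      using \<alpha> X(1) unfolding proper_colouring_def by blast
  qed
qed

lemma proper_colouring_restrict:
  assumes "proper_colouring F C S \<alpha>"
  shows "proper_colouring F C (S - {v}) (restrict \<alpha> (S - {v}))"
  unfolding proper_colouring_def
proof (intro conjI ballI impI notI)
  show "restrict \<alpha> (S - {v}) \<in> (S - {v}) \<rightarrow>\<^sub>E C"
    using assms by (auto simp: proper_colouring_def)
next
  fix X assume X: "X \<in> F" "X \<subseteq> S - {v}" and "\<exists>c. \<forall>x\<in>X. restrict \<alpha> (S - {v}) x = c"
  then have "\<exists>c. \<forall>x\<in>X. \<alpha> x = c"
    by (metis restrict_apply' subsetD)
  then show False
    using assms X unfolding proper_colouring_def by blast
qed

text \<open>At most \<open>card N + 1\<close> colours are excluded. The extra one, \<open>d\<close>,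
  will be the colour that another vertex is about to receive.\<close>

lemma ex_absent_colour:
  assumes "finite N" and "card N + 2 \<le> card C"
  shows "\<exists>c\<in>C. c \<notin> \<alpha> ` N \<and> c \<noteq> d"
proof -
  have "card (insert d (\<alpha> ` N)) < card C"
    using assms card_image_le[of N \<alpha>] by (simp add: card_insert_if)
  then have "\<not> C \<subseteq> insert d (\<alpha> ` N)"
    using assms(1) by (meson card_mono finite_imageI finite_insert leD)
  then show ?thesis
    by blast
qed

text \<open>Induction along the sequence on \<open>S - {v}\<close>. Colour \<open>d\<close> is
  existential because the moves of \<open>v\<close> are forced by the other vertices, so its final
  colour cannot be prescribed.\<close>

lemma recolouring_lift:
  assumes "(\<alpha>, \<beta>) \<in> (recolouring F C (S - {v}))\<^sup>*"
    and "v \<in> S" and N: "blocks F S N v" "finite N" "card N + 2 \<le> card C"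
    and "proper_colouring F C S (\<alpha>(v := c))"
  shows "\<exists>d. proper_colouring F C S (\<beta>(v := d)) \<and>
    (\<alpha>(v := c), \<beta>(v := d)) \<in> (recolouring F C S)\<^sup>*"
  using assms(1)
proof induction
  case base
  show ?case
    using assms(6) by blast
next
  case (step \<beta> \<gamma>)
  then obtain d where d: "proper_colouring F C S (\<beta>(v := d))"
      "(\<alpha>(v := c), \<beta>(v := d)) \<in> (recolouring F C S)\<^sup>*"
    by blast
  from step.hyps(2) obtain u where \<beta>: "proper_colouring F C (S - {v}) \<beta>"
      and \<gamma>: "proper_colouring F C (S - {v}) \<gamma>"
      and u: "\<And>x. x \<in> S - {v} \<Longrightarrow> x \<noteq> u \<Longrightarrow> \<beta> x = \<gamma> x"
    unfolding recolouring_def by blast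
  \<comment> \<open>Off \<open>S - {v}\<close>, in particular at \<open>v\<close>, both colourings
    are \<open>undefined\<close> by extensionality.\<close>
  have agree: "\<beta> x = \<gamma> x" if "x \<noteq> u" for x
    using u that \<beta> \<gamma> unfolding proper_colouring_def by (metis PiE_arb)
  \<comment> \<open>Passing from \<beta> to \<gamma> brings at most the colour
    \<open>\<gamma> u\<close> into \<open>N\<close>. Hence \<open>e\<close> is absent from
    \<open>N\<close> both before and after \<open>u\<close> changes, and \<open>v\<close> can wait
    there.\<close>
  obtain e where e: "e \<in> C" "e \<notin> \<beta> ` N" "e \<noteq> \<gamma> u"
    using ex_absent_colour[OF N(2,3)] by blast
  then have "e \<notin> \<gamma> ` N"
    using \<open>e \<noteq> \<gamma> u\<close> agree by (auto simp: image_iff) metis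
  then have \<beta>e: "proper_colouring F C S (\<beta>(v := e))"
    and \<gamma>e: "proper_colouring F C S (\<gamma>(v := e))"
    using proper_colouring_fun_upd[OF _ \<open>v \<in> S\<close> N(1) e(1)] \<beta> \<gamma> e(2) by blast+
  have "(\<beta>(v := d), \<beta>(v := e)) \<in> (recolouring F C S)\<^sup>*"
    by (rule recolouring_at_vertex[OF d(1) \<beta>e, of v]) simp
  also have "(\<beta>(v := e), \<gamma>(v := e)) \<in> (recolouring F C S)\<^sup>*"
    by (rule recolouring_at_vertex[OF \<beta>e \<gamma>e, of u]) (simp add: agree)
  finally show ?case
    using d(2) \<gamma>e by (meson rtrancl_trans)
qed

text \<open>The hypothesis speaks of all nonempty subsets so that it passes to
  \<open>S - {v}\<close>. Existence is proved alongside, because the colouring graph must be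
  non-null.\<close>

lemma recolouring_connected:
  assumes "finite S" and "{} \<notin> F"
    and "\<And>T. T \<subseteq> S \<Longrightarrow> T \<noteq> {} \<Longrightarrow>
      \<exists>v\<in>T. \<exists>N. blocks F T N v \<and> finite N \<and> card N + 2 \<le> card C"
  shows "(\<exists>\<alpha>. proper_colouring F C S \<alpha>) \<and>
    (\<forall>\<alpha> \<beta>. proper_colouring F C S \<alpha> \<longrightarrow> proper_colouring F C S \<beta> \<longrightarrow>
      (\<alpha>, \<beta>) \<in> (recolouring F C S)\<^sup>*)"
  using assms(1,3)
proof (induction S rule: finite_psubset_induct)
  case (psubset S)
  show ?case
  proof (cases "S = {}")
    case True
    \<comment> \<open>The only colouring of the empty set is \<open>undefined\<close> everywhere; an
      empty hyperedge would be vacuously monochromatic under it.\<close>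
    then show ?thesis
      using assms(2) by (auto simp: proper_colouring_def)
  next
    case False
    then obtain v N where v: "v \<in> S"
        and N: "blocks F S N v" "finite N" "card N + 2 \<le> card C"
      using psubset.prems by blast
    have IH: "(\<exists>\<alpha>. proper_colouring F C (S - {v}) \<alpha>) \<and>
      (\<forall>\<alpha> \<beta>. proper_colouring F C (S - {v}) \<alpha> \<longrightarrow> proper_colouring F C (S - {v}) \<beta> \<longrightarrow>
        (\<alpha>, \<beta>) \<in> (recolouring F C (S - {v}))\<^sup>*)"
    proof (rule psubset.IH)
      show "S - {v} \<subset> S"
        using v by blast
    qed (use psubset.prems in blast)
    then obtain \<alpha> where "proper_colouring F C (S - {v}) \<alpha>"
      by blast
    moreover obtain c where "c \<in> C" "c \<notin> \<alpha> ` N"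
      using ex_absent_colour[OF N(2,3)] by blast
    ultimately have "proper_colouring F C S (\<alpha>(v := c))"
      using v N(1) by (intro proper_colouring_fun_upd)
    moreover have "(\<alpha>, \<beta>) \<in> (recolouring F C S)\<^sup>*"
      if \<alpha>: "proper_colouring F C S \<alpha>" and \<beta>: "proper_colouring F C S \<beta>" for \<alpha> \<beta>
    proof -
      let ?r = "\<lambda>\<alpha>. restrict \<alpha> (S - {v})"
      have upd: "(?r \<alpha>)(v := \<alpha> v) = \<alpha>" if "proper_colouring F C S \<alpha>" for \<alpha>
        using that by (auto simp: fun_eq_iff proper_colouring_def PiE_def extensional_def)
      have "(?r \<alpha>, ?r \<beta>) \<in> (recolouring F C (S - {v}))\<^sup>*"
        using IH \<alpha> \<beta> by (blast intro: proper_colouring_restrict)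
      from recolouring_lift[OF this v N, of "\<alpha> v", unfolded upd[OF \<alpha>], OF \<alpha>]
      obtain d
        where d: "proper_colouring F C S ((?r \<beta>)(v := d))"
          "(\<alpha>, (?r \<beta>)(v := d)) \<in> (recolouring F C S)\<^sup>*"
        by blast
      note d(2)
      \<comment> \<open>The lifted sequence ends at \<beta> except perhaps at \<open>v\<close>; one
        last recolouring of \<open>v\<close> corrects this.\<close>
      also have "((?r \<beta>)(v := d), \<beta>) \<in> (recolouring F C S)\<^sup>*"
        by (rule recolouring_at_vertex[OF d(1) \<beta>, of v]) (metis upd[OF \<beta>] fun_upd_other)
      finally show ?thesis .
    qed
    ultimately show ?thesis
      by blast
  qed
qed

section \<open>Directed cycles and degeneracy\<close>

context pre_digraph
begin

text \<open>The vertices of a walk are its tails followed by the last head, and also the first tail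
  followed by its heads. On a closed walk the two additional vertices coincide, and each already
  lies in the respective set.\<close>

lemma heads_eq_tails_cycle:
  assumes "cycle p"
  shows "head G ` set p = tail G ` set p"
proof -
  from assms obtain u where "cas u p u" and "p \<noteq> []"
    unfolding cycle_def awalk_def by blast
  from \<open>cas u p u\<close> have *: "map (tail G) p @ [head G (last p)] = tail G (hd p) # map (head G) p"
    using awalk_verts_conv[of u p] awalk_verts_conv'[of u p u] \<open>p \<noteq> []\<close> by simp
  have "head G (last p) = tail G (hd p)"
  proof -
    have "cas x p y \<Longrightarrow> p \<noteq> [] \<Longrightarrow> head G (last p) = y" for x y
      by (induction p arbitrary: x) auto
    moreover have "tail G (hd p) = u"
      using \<open>cas u p u\<close> \<open>p \<noteq> []\<close> by (simp add: cas_simp)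
    ultimately show ?thesis
      using \<open>cas u p u\<close> \<open>p \<noteq> []\<close> by simp
  qed
  moreover have "tail G (hd p) \<in> tail G ` set p" "head G (last p) \<in> head G ` set p"
    using \<open>p \<noteq> []\<close> by auto
  moreover have "insert (head G (last p)) (tail G ` set p) = insert (tail G (hd p)) (head G ` set p)"
    using arg_cong[OF *, of set] by simp
  ultimately show ?thesis
    by (metis insert_absorb)
qed

lemma cycle_arcs_subset: "cycle p \<Longrightarrow> set p \<subseteq> arcs G"
  by (auto simp: cycle_def awalk_def)

end

context digraph
begin

definition cycle_verts :: "'a set set" where
  "cycle_verts = {tail G ` set p | p. cycle p}"

lemma empty_notin_cycle_verts: "{} \<notin> cycle_verts"
  by (auto simp: cycle_verts_def cycle_def)

text \<open>A cycle through \<open>v\<close> leaves it by an arc whose head is again on the cycle,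
  hence in \<open>S\<close>; without loops this head is not \<open>v\<close>.\<close>

lemma blocks_out_neighbours:
  assumes "v \<in> S"
  shows "blocks cycle_verts S (head G ` out_arcs (G \<restriction> S) v) v"
  unfolding blocks_def
proof (intro conjI ballI impI)
  show "head G ` out_arcs (G \<restriction> S) v \<subseteq> S - {v}"
    by (auto simp: out_arcs_def dest: no_loops)
next
  fix X assume "X \<in> cycle_verts" "X \<subseteq> S" "v \<in> X"
  then obtain p e where p: "cycle p" "X = tail G ` set p" and e: "e \<in> set p" "v = tail G e"
    by (auto simp: cycle_verts_def)
  then have "head G e \<in> X"
    using heads_eq_tails_cycle by blast
  moreover have "e \<in> out_arcs (G \<restriction> S) v"
    using cycle_arcs_subset[OF p(1)] e assms \<open>head G e \<in> X\<close> \<open>X \<subseteq> S\<close> by (auto simp: out_arcs_def)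
  ultimately show "X \<inter> head G ` out_arcs (G \<restriction> S) v \<noteq> {}"
    by blast
qed

text \<open>Dually, \<open>v\<close> is the head of some arc of the cycle, and the tail of that arc
  lies on the cycle.\<close>

lemma blocks_in_neighbours:
  assumes "v \<in> S"
  shows "blocks cycle_verts S (tail G ` in_arcs (G \<restriction> S) v) v"
  unfolding blocks_def
proof (intro conjI ballI impI)
  show "tail G ` in_arcs (G \<restriction> S) v \<subseteq> S - {v}"
    by (auto simp: in_arcs_def dest: no_loops)
next
  fix X assume "X \<in> cycle_verts" "X \<subseteq> S" "v \<in> X"
  then obtain p where p: "cycle p" "X = tail G ` set p"
    by (auto simp: cycle_verts_def)
  then obtain e where e: "e \<in> set p" "v = head G e"
    using heads_eq_tails_cycle \<open>v \<in> X\<close> by blast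
  then have "tail G e \<in> X"
    using p(2) by blast
  moreover have "e \<in> in_arcs (G \<restriction> S) v"
    using cycle_arcs_subset[OF p(1)] e assms \<open>tail G e \<in> X\<close> \<open>X \<subseteq> S\<close> by (auto simp: in_arcs_def)
  ultimately show "X \<inter> tail G ` in_arcs (G \<restriction> S) v \<noteq> {}"
    by blast
qed

section \<open>Small blocking sets from min-degeneracy\<close>

lemma min_degree_le_min_degeneracy:
  assumes "subgraph H G" and "verts H \<noteq> {}"
  shows "min (min_out_degree H) (min_in_degree H) \<le> min_degeneracy G"
  unfolding min_degeneracy_def
proof (rule cSup_upper)
  \<comment> \<open>\<open>Sup\<close> on the naturals dominates the members only of a bounded set;
    the number of arcs of \<open>G\<close> is a common bound.\<close>
  have "min (min_out_degree K) (min_in_degree K) \<le> card (arcs G)"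
    if K: "subgraph K G" "verts K \<noteq> {}" for K
  proof -
    have "finite (verts K)" and "arcs K \<subseteq> arcs G"
      using K by (auto simp: subgraph_def intro: finite_subset[OF _ finite_verts])
    then have "min_out_degree K \<in> out_degree K ` verts K"
      unfolding min_out_degree_def using K(2) by (intro Min_in) auto
    then obtain v where "min_out_degree K = card (out_arcs K v)"
      by (auto simp: out_degree_def)
    also have "\<dots> \<le> card (arcs G)"
      using \<open>arcs K \<subseteq> arcs G\<close> by (intro card_mono) (auto simp: out_arcs_def)
    finally show ?thesis
      by simp
  qed
  then show "bdd_above {min (min_out_degree H) (min_in_degree H) | H. subgraph H G \<and> verts H \<noteq> {}}"
    by (intro bdd_aboveI[of _ "card (arcs G)"]) blast
qed (use assms in blast)

text \<open>In the subdigraph induced by \<open>S\<close>, the minimum out-degree or the minimum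
  in-degree is at most the min-degeneracy. A vertex attaining it is blocked by its neighbours on
  that side.\<close>

lemma ex_blocked_vertex:
  assumes "S \<subseteq> verts G" and "S \<noteq> {}"
  shows "\<exists>v\<in>S. \<exists>N. blocks cycle_verts S N v \<and> finite N \<and> card N \<le> min_degeneracy G"
proof -
  let ?H = "G \<restriction> S"
  have fin: "finite S"
    using assms(1) finite_subset finite_verts by blast
  have fin_out: "finite (out_arcs ?H v)" and fin_in: "finite (in_arcs ?H v)" for v
    by (simp_all add: out_arcs_def in_arcs_def)
  have "subgraph ?H G"
    using assms(1) induced_imp_subgraph induced_induce by blast
  then have "min (min_out_degree ?H) (min_in_degree ?H) \<le> min_degeneracy G"
    using assms(2) by (intro min_degree_le_min_degeneracy) simp_all
  then consider "min_out_degree ?H \<le> min_degeneracy G" | "min_in_degree ?H \<le> min_degeneracy G"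
    by linarith
  then show ?thesis
  proof cases
    case 1
    have "min_out_degree ?H \<in> out_degree ?H ` S"
      unfolding min_out_degree_def using fin assms(2) by simp
    then obtain v where "v \<in> S" "card (out_arcs ?H v) \<le> min_degeneracy G"
      using 1 by (auto simp: out_degree_def)
    then show ?thesis
      using blocks_out_neighbours fin_out card_image_le[OF fin_out] by (meson finite_imageI order_trans)
  next
    case 2
    have "min_in_degree ?H \<in> in_degree ?H ` S"
      unfolding min_in_degree_def using fin assms(2) by simp
    then obtain v where "v \<in> S" "card (in_arcs ?H v) \<le> min_degeneracy G"
      using 2 by (auto simp: in_degree_def)
    then show ?thesis
      using blocks_in_neighbours fin_in card_image_le[OF fin_in] by (meson finite_imageI order_trans)
  qed
qed

section \<open>From hypergraph colourings back to dicolourings\<close>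

lemma dicolouring_iff_proper_colouring:
  "dicolouring G k = proper_colouring cycle_verts {1..k} (verts G)"
proof -
  \<comment> \<open>Thus the side condition \<open>X \<subseteq> S\<close> of
    \<open>proper_colouring\<close> holds for every cycle when \<open>S\<close> is the full vertex
    set.\<close>
  have "tail G ` set p \<subseteq> verts G" if "cycle p" for p
    using cycle_arcs_subset[OF that] by auto
  then show ?thesis
    by (fastforce simp: fun_eq_iff dicolouring_def proper_colouring_def cycle_verts_def
        monochromatic_def)
qed

lemma parcs_dicolouring_graph:
  "parcs (dicolouring_graph G k) = recolouring cycle_verts {1..k} (verts G)"
  by (simp add: dicolouring_graph_def recolouring_def dicolouring_iff_proper_colouring)

end

lemma connected_with_projI:
  assumes "pair_wf_digraph K" and "pverts K \<noteq> {}"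
    and "\<And>x y. x \<in> pverts K \<Longrightarrow> y \<in> pverts K \<Longrightarrow> (x, y) \<in> (parcs K)\<^sup>*"
  shows "Digraph_Component.connected (with_proj K)"
proof -
  interpret pair_wf_digraph K
    by fact
  have "x \<rightarrow>\<^sup>*\<^bsub>with_proj K\<^esub> y" if x: "x \<in> pverts K" and y: "y \<in> pverts K" for x y
    using assms(3)[OF x y]
  proof induction
    \<comment> \<open>Reachability of a vertex from itself requires membership in the graph, which
      the reflexive closure \<open>(parcs K)\<^sup>*\<close> does not give.\<close>
    case base
    then show ?case
      using x by (simp add: reachable_def)
  next
    case (step y z)
    then show ?case
      by (metis reachable_adj_trans)
  qed
  then show ?thesis
    \<comment> \<open>\<open>connected\<close> means strong connectedness of the symmetric closure,
      which inherits reachability from the graph itself.\<close>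
    unfolding Digraph_Component.connected_def strongly_connected_def
    using assms(2) reachable_mk_symmetricI by simp
qed

theorem theorem6:
  fixes D :: "('a, 'b) pre_digraph" and k :: nat
  assumes "digraph D"
    and "k \<ge> min_degeneracy D + 2"
  shows "k_mixing D k"
proof -
  interpret digraph D
    by fact
  let ?R = "recolouring cycle_verts {1..k} (verts D)"
  have "\<exists>v\<in>T. \<exists>N. blocks cycle_verts T N v \<and> finite N \<and> card N + 2 \<le> card {1..k}"
    if "T \<subseteq> verts D" "T \<noteq> {}" for T
    using ex_blocked_vertex[OF that] assms(2) by fastforce
  from recolouring_connected[OF finite_verts empty_notin_cycle_verts this]
  have "\<exists>\<alpha>. dicolouring D k \<alpha>"
    and "\<And>\<alpha> \<beta>. dicolouring D k \<alpha> \<Longrightarrow> dicolouring D k \<beta> \<Longrightarrow> (\<alpha>, \<beta>) \<in> ?R\<^sup>*"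
    unfolding dicolouring_iff_proper_colouring by blast+
  moreover have "pverts (dicolouring_graph D k) = {\<alpha>. dicolouring D k \<alpha>}"
    by (simp add: dicolouring_graph_def)
  moreover have "pair_wf_digraph (dicolouring_graph D k)"
    by unfold_locales (auto simp: dicolouring_graph_def)
  ultimately show ?thesis
    unfolding k_mixing_def by (intro connected_with_projI) (auto simp: parcs_dicolouring_graph)
qed

end
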